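(* For every integer $n\geqslant 0$ and every $r\in\{1,2\}$, $$p(n) = (-1)^{r-1} \sum_{k=r}^{n+r} S^{(r)}_{n+r,k}\, \mu(k).$$
   Context: $p(n)$ denotes the number of partitions of the non-negative integer $n$ (with $p(0)=1$). $\mu$ is the classical Möbius function on positive integers: $\mu(m)=0$ if $m$ is divisible by the square of a prime, and $\mu(m)=(-1)^s$ if $m$ is a product of $s\geqslant 0$ distinct primes. For integers $r\geqslant 1$, $k\geqslant 1$, $m\geqslant 0$, $S^{(r)}_{m,k}$ denotes the number of $k$'s in the partitions of $m$ with smallest part at least $r$, i.e. the total number of occurrences (with multiplicity) of the part $k$ summed over all partitions of $m$ all of whose parts are $\geqslant r$. *)

theory Defs
  imports "HOL-Library.Multiset" "HOL-Computational_Algebra.Primes"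
begin

text \<open>A partition of \<open>n\<close> is the multiset of its (positive) parts.\<close>

definition partitions :: "nat \<Rightarrow> nat multiset set" where
  "partitions n = {M. (\<forall>i\<in>#M. 0 < i) \<and> \<Sum>\<^sub># M = n}"

text \<open>Finiteness ensures that the \<open>card\<close> and \<open>\<Sum>\<close> below are genuine counts.\<close>

lemma finite_partitions: "finite (partitions n)"
proof (rule finite_subset)
  show "partitions n \<subseteq> mset ` {xs. set xs \<subseteq> {..n} \<and> length xs \<le> n}"
  proof
    fix M assume "M \<in> partitions n"
    then have pos: "\<And>i. i \<in># M \<Longrightarrow> 0 < i" and sum: "\<Sum>\<^sub># M = n"
      by (auto simp: partitions_def)
    obtain xs where xs: "mset xs = M"
      using ex_mset by blast
    have "i \<le> n" if "i \<in># M" for i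
      using multi_member_split[OF that] sum by auto
    then have "set xs \<subseteq> {..n}"
      using xs by auto
    moreover have "size M \<le> \<Sum>\<^sub># M"
      using pos by (induction M) (auto simp: Suc_le_eq intro: add_pos_nonneg add_strict_increasing)
    then have "length xs \<le> n"
      using xs sum by auto
    ultimately show "M \<in> mset ` {xs. set xs \<subseteq> {..n} \<and> length xs \<le> n}"
      using xs by blast
  qed
qed (simp add: finite_lists_length_le)

definition num_partitions :: "nat \<Rightarrow> nat" where
  "num_partitions n = card (partitions n)"

text \<open>The total number of occurrences, with multiplicity, of the part \<open>k\<close> in all
  partitions of \<open>m\<close> whose smallest part is at least \<open>r\<close>.\<close>

definition num_parts :: "nat \<Rightarrow> nat \<Rightarrow> nat \<Rightarrow> nat" where
  "num_parts r m k = (\<Sum>M\<in>{M \<in> partitions m. \<forall>i\<in>#M. r \<le> i}. count M k)"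

definition moebius_mu :: "nat \<Rightarrow> int" where
  "moebius_mu m = (if \<exists>p. prime p \<and> p\<^sup>2 dvd m then 0 else (-1) ^ card (prime_factors m))"

end

theory Submission
  imports Defs "HOL-Computational_Algebra.Squarefree"
begin

text \<open>Removing one copy of the part \<open>k\<close> shows that \<open>S\<^sup>(\<^sup>r\<^sup>)\<^sub>m\<^sub>,\<^sub>k\<close> is the sum of \<open>p\<^sub>r(i)\<close> over all
  \<open>i < m\<close> with \<open>k dvd m - i\<close>, where \<open>p\<^sub>r\<close> counts the partitions into parts at least \<open>r\<close>. After
  exchanging the order of summation, the inner sum is the sum of \<open>\<mu>\<close> over the divisors of \<open>m - i\<close>
  that are at least \<open>r\<close>. For \<open>r = 1\<close> it vanishes unless \<open>i = m - 1\<close>. For \<open>r = 2\<close> the divisor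
  \<open>1\<close> is missing, so it is \<open>-1\<close> for each \<open>i \<le> m - 2\<close> and \<open>0\<close> for \<open>i = m - 1\<close>; it remains to use
  that \<open>p(n)\<close> is the sum of \<open>p\<^sub>2(i)\<close> over \<open>i \<le> n\<close>, by deleting all parts equal to \<open>1\<close>.\<close>

lemma moebius_mu_not_squarefree: "\<not> squarefree n \<Longrightarrow> n > 0 \<Longrightarrow> moebius_mu n = 0"
  by (auto simp: moebius_mu_def squarefree_factorial_semiring)

lemma moebius_mu_squarefree: "squarefree n \<Longrightarrow> moebius_mu n = (-1) ^ card (prime_factors n)"
  unfolding moebius_mu_def squarefree_def by (metis not_prime_unit)

lemma moebius_mu_1: "moebius_mu 1 = 1"
  by (simp add: moebius_mu_squarefree)

text \<open>Coprimality keeps \<open>p * d\<close> squarefree, and its one additional prime factor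
  flips the sign.\<close>

lemma moebius_mu_prime_mult:
  assumes "prime p" "\<not> p dvd d" "squarefree d"
  shows "moebius_mu (p * d) = - moebius_mu d"
proof -
  have "squarefree (p * d)"
    using assms by (intro squarefree_mult_coprime) (auto simp: prime_imp_coprime squarefree_prime)
  moreover have "d \<noteq> 0" using assms(2) by (metis dvd_0_right)
  then have "prime_factors (p * d) = insert p (prime_factors d)"
    using assms by (subst prime_factors_product) (auto simp: prime_prime_factors)
  moreover have "p \<notin> prime_factors d" using assms by auto
  ultimately show ?thesis
    using assms by (simp add: moebius_mu_squarefree)
qed

text \<open>For \<open>t > 1\<close> fix a prime \<open>p\<close> dividing \<open>t\<close>. Only
  squarefree divisors contribute, and multiplication by \<open>p\<close> maps those prime to
  \<open>p\<close> (\<open>A\<close>) bijectively onto those divisible by \<open>p\<close>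
  (\<open>B\<close>) while reversing the sign, so the two sums cancel.\<close>

lemma sum_moebius_mu_divisors:
  assumes "t > 0"
  shows "(\<Sum>d | d dvd t. moebius_mu d) = (if t = 1 then 1 else 0)"
proof (cases "t = 1")
  case True
  then show ?thesis using moebius_mu_1 by simp
next
  case False
  then obtain p where p: "prime p" "p dvd t"
    using prime_factor_nat by blast
  define A where "A = {d. d dvd t \<and> squarefree d \<and> \<not> p dvd d}"
  define B where "B = {d. d dvd t \<and> squarefree d \<and> p dvd d}"
  have fin: "finite {d. d dvd t}" using assms by simp
  have finAB: "finite A" "finite B"
    by (auto intro: finite_subset[OF _ fin] simp: A_def B_def)
  have "B \<subseteq> (*) p ` A"
  proof
    fix b assume b: "b \<in> B"
    then obtain a where a: "b = p * a" by (auto simp: B_def)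
    have "squarefree a" using b squarefree_multD(2) a by (auto simp: B_def)
    moreover have "\<not> p dvd a"
    proof
      assume "p dvd a"
      then have "p\<^sup>2 dvd b" using a by (auto simp: power2_eq_square)
      then have "p dvd 1" using b unfolding B_def squarefree_def by blast
      then show False using p by auto
    qed
    moreover have "a dvd t" using b a by (auto simp: B_def elim: dvd_mult_right)
    ultimately show "b \<in> (*) p ` A" using a by (auto simp: A_def)
  qed
  moreover have "p * a \<in> B" if "a \<in> A" for a
  proof -
    have c: "coprime p a" using that p by (auto simp: A_def prime_imp_coprime)
    moreover have "p * a dvd t" using that p c by (auto simp: A_def divides_mult)
    ultimately show ?thesis
      using that p by (auto simp: A_def B_def squarefree_prime intro: squarefree_mult_coprime)
  qed
  ultimately have B: "B = (*) p ` A" by blast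
  have "(\<Sum>d | d dvd t. moebius_mu d) = sum moebius_mu (A \<union> B)"
  proof (rule sum.mono_neutral_right[OF fin])
    show "\<forall>d\<in>{d. d dvd t} - (A \<union> B). moebius_mu d = 0"
      using moebius_mu_not_squarefree dvd_pos_nat[OF assms] by (auto simp: A_def B_def)
  qed (auto simp: A_def B_def)
  also have "\<dots> = sum moebius_mu A + sum moebius_mu B"
    using finAB by (intro sum.union_disjoint) (auto simp: A_def B_def)
  also have "sum moebius_mu B = (\<Sum>a\<in>A. moebius_mu (p * a))"
    unfolding B using p by (subst sum.reindex) (auto simp: inj_on_def)
  also have "\<dots> = - sum moebius_mu A"
    unfolding sum_negf[symmetric]
    using p by (intro sum.cong) (auto simp: A_def moebius_mu_prime_mult)
  finally show ?thesis using False by simp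
qed

lemma sum_moebius_mu_divisors_ge:
  assumes "t > 0" "r = 1 \<or> r = 2"
  shows "(\<Sum>d | d dvd t \<and> r \<le> d. moebius_mu d) =
    (if t = 1 then 1 else 0) - (if r = 2 then 1 else 0)"
proof -
  have "d > 0" if "d dvd t" for d
    using dvd_pos_nat[OF assms(1) that] .
  then have eq: "{d. d dvd t \<and> r \<le> d} = {d. d dvd t} - (if r = 2 then {1} else {})"
    using assms(2) by (auto simp: numeral_2_eq_2 Suc_le_eq intro: Suc_lessI)
  show ?thesis
    using assms(1) unfolding eq by (simp add: sum_diff1 sum_moebius_mu_divisors moebius_mu_1[simplified])
qed

definition restricted_partitions :: "nat \<Rightarrow> nat \<Rightarrow> nat multiset set" where
  "restricted_partitions r m = {M \<in> partitions m. \<forall>i\<in>#M. r \<le> i}"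

lemma finite_restricted_partitions: "finite (restricted_partitions r m)"
  by (simp add: restricted_partitions_def finite_partitions)

lemma restricted_partitions_1: "restricted_partitions 1 m = partitions m"
  by (auto simp: restricted_partitions_def partitions_def Suc_le_eq)

text \<open>Deleting one copy of \<open>k\<close> inverts inserting one; \<open>r \<le> k\<close>
  keeps the enlarged multiset admissible, and \<open>k \<le> m\<close> rules out truncation in
  \<open>m - k\<close>.\<close>

lemma restricted_partitions_containing:
  assumes "0 < k" "r \<le> k" "k \<le> m"
  shows "{M \<in> restricted_partitions r m. k \<in># M} = add_mset k ` restricted_partitions r (m - k)"
proof (intro equalityI subsetI)
  fix M assume M: "M \<in> {M \<in> restricted_partitions r m. k \<in># M}"
  then obtain N where "M = add_mset k N" using multi_member_split[of k M] by blast
  with M show "M \<in> add_mset k ` restricted_partitions r (m - k)"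
    by (auto simp: restricted_partitions_def partitions_def)
qed (use assms in \<open>auto simp: restricted_partitions_def partitions_def\<close>)

lemma part_le: "M \<in> partitions m \<Longrightarrow> k \<in># M \<Longrightarrow> k \<le> m"
  using multi_member_split[of k M] by (auto simp: partitions_def)

text \<open>The parts equal to 1 are stripped one at a time, by induction: a partition of
  \<open>Suc n\<close> either contains a 1, whose removal leaves an arbitrary partition of
  \<open>n\<close>, or has all parts at least 2.\<close>

lemma num_partitions_eq_sum: "num_partitions n = (\<Sum>i\<le>n. card (restricted_partitions 2 i))"
proof (induction n)
  case 0
  have "M = {#}" if "M \<in> partitions 0" for M
  proof (rule ccontr)
    assume "M \<noteq> {#}"
    then obtain k where "k \<in># M" by (rule multiset_nonemptyE)
    then show False using part_le[OF that] that by (auto simp: partitions_def)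
  qed
  then have "partitions 0 = {{#}}" "restricted_partitions 2 0 = {{#}}"
    by (auto simp: partitions_def restricted_partitions_def)
  then show ?case by (simp add: num_partitions_def)
next
  case (Suc n)
  have "partitions (Suc n) = add_mset 1 ` partitions n \<union> restricted_partitions 2 (Suc n)"
  proof -
    have "{M \<in> partitions (Suc n). 1 \<in># M} = add_mset 1 ` partitions n"
      using restricted_partitions_containing[of 1 1 "Suc n"]
      by (simp add: restricted_partitions_1[simplified])
    moreover have "{M \<in> partitions (Suc n). 1 \<notin># M} = restricted_partitions 2 (Suc n)"
      unfolding restricted_partitions_def partitions_def
      by (auto simp: numeral_2_eq_2 Suc_le_eq) (metis Suc_lessI)
    ultimately show ?thesis by blast
  qed
  moreover have "add_mset 1 ` partitions n \<inter> restricted_partitions 2 (Suc n) = {}"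
    by (auto simp: restricted_partitions_def)
  ultimately have "card (partitions (Suc n)) =
    card (add_mset 1 ` partitions n) + card (restricted_partitions 2 (Suc n))"
    by (simp add: card_Un_disjoint finite_partitions finite_restricted_partitions)
  then show ?case
    using Suc by (simp add: num_partitions_def card_image inj_on_def)
qed

lemma num_parts_eq_0:
  assumes "m < k"
  shows "num_parts r m k = 0"
proof -
  have "count M k = 0" if "M \<in> partitions m" for M
    using part_le[OF that, of k] assms by (auto simp: not_in_iff[symmetric])
  then show ?thesis by (simp add: num_parts_def)
qed

text \<open>Only partitions containing \<open>k\<close> contribute. Each is
  \<open>add_mset k N\<close> for a unique \<open>N\<close>: the inserted copies give the
  cardinality, the copies already in \<open>N\<close> the recursive term.\<close>

lemma num_parts_rec:
  assumes "0 < k" "r \<le> k" "k \<le> m"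
  shows "num_parts r m k = card (restricted_partitions r (m - k)) + num_parts r (m - k) k"
proof -
  have "num_parts r m k = (\<Sum>M\<in>{M \<in> restricted_partitions r m. k \<in># M}. count M k)"
    unfolding num_parts_def restricted_partitions_def[symmetric]
    by (rule sum.mono_neutral_right)
      (auto simp: finite_restricted_partitions not_in_iff)
  also have "\<dots> = (\<Sum>M\<in>restricted_partitions r (m - k). count (add_mset k M) k)"
    unfolding restricted_partitions_containing[OF assms]
    by (subst sum.reindex) (auto simp: inj_on_def)
  also have "\<dots> = card (restricted_partitions r (m - k)) + num_parts r (m - k) k"
    by (simp add: num_parts_def restricted_partitions_def sum_Suc)
  finally show ?thesis .
qed

text \<open>This unrolls the recursion: the indices are \<open>m - k\<close>,
  \<open>m - 2 * k\<close> and so on, as long as they are nonnegative.\<close>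

lemma num_parts_eq_sum:
  assumes "0 < k" "r \<le> k"
  shows "num_parts r m k = (\<Sum>i | i < m \<and> k dvd m - i. card (restricted_partitions r i))"
proof (induction m rule: less_induct)
  case (less m)
  show ?case
  proof (cases "k \<le> m")
    case True
    have le: "i \<le> m - k" if "i < m" "k dvd m - i" for i
      using that dvd_imp_le[of k "m - i"] by auto
    have dvd: "k dvd m - i \<longleftrightarrow> k dvd m - k - i" if "i \<le> m - k" for i
    proof -
      have "m - i = k + (m - k - i)" using that True by simp
      then show ?thesis by (metis dvd_add_triv_left_iff)
    qed
    have eq: "{i. i < m \<and> k dvd m - i} = insert (m - k) {i. i < m - k \<and> k dvd m - k - i}"
    proof (rule set_eqI)
      fix i
      consider "i < m - k" | "i = m - k" | "i > m - k" by linarith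
      then show "i \<in> {i. i < m \<and> k dvd m - i} \<longleftrightarrow>
          i \<in> insert (m - k) {i. i < m - k \<and> k dvd m - k - i}"
      proof cases
        case 1
        then show ?thesis using dvd[of i] by auto
      next
        case 2
        then show ?thesis using True assms by simp
      next
        case 3
        then show ?thesis using le[of i] by auto
      qed
    qed
    have "m - k < m" using True assms by simp
    from less[OF this] show ?thesis
      unfolding eq num_parts_rec[OF assms True] by simp
  next
    case False
    then have eq: "{i. i < m \<and> k dvd m - i} = {}"
      by (auto dest!: dvd_imp_le)
    show ?thesis unfolding eq using num_parts_eq_0[of m k r] False by simp
  qed
qed

lemma sum_num_parts_moebius_mu:
  assumes "0 < r"
  shows "(\<Sum>k = r..m. int (num_parts r m k) * moebius_mu k) =
    (\<Sum>i<m. int (card (restricted_partitions r i)) * (\<Sum>k | k dvd m - i \<and> r \<le> k. moebius_mu k))"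
proof -
  have "(\<Sum>k = r..m. int (num_parts r m k) * moebius_mu k) =
    (\<Sum>k\<in>{r..m}. \<Sum>i | i \<in> {..<m} \<and> k dvd m - i.
      int (card (restricted_partitions r i)) * moebius_mu k)"
    using assms by (intro sum.cong) (auto simp: num_parts_eq_sum sum_distrib_right)
  also have "\<dots> = (\<Sum>i\<in>{..<m}. \<Sum>k | k \<in> {r..m} \<and> k dvd m - i.
      int (card (restricted_partitions r i)) * moebius_mu k)"
    by (rule sum.swap_restrict) auto
  also have "\<dots> = (\<Sum>i<m. int (card (restricted_partitions r i)) *
      (\<Sum>k | k dvd m - i \<and> r \<le> k. moebius_mu k))"
    unfolding sum_distrib_left
    \<comment> \<open>The bound \<open>k \<le> m\<close> is automatic, since \<open>k\<close>
      divides the positive number \<open>m - i\<close>.\<close>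
    by (intro sum.cong) (auto dest: dvd_imp_le)
  finally show ?thesis .
qed

theorem theorem1p1:
  fixes n r :: nat
  assumes "r \<in> {1, 2}"
  shows "int (num_partitions n) =
    (-1) ^ (r - 1) * (\<Sum>k = r..n + r. int (num_parts r (n + r) k) * moebius_mu k)"
proof -
  let ?c = "\<lambda>i. int (card (restricted_partitions r i))"
  let ?\<delta> = "(if r = 2 then 1 else 0) :: int"
  have r: "0 < r" "r = 1 \<or> r = 2" using assms by auto
  have divisors: "(\<Sum>k | k dvd n + r - i \<and> r \<le> k. moebius_mu k) =
      (if i = n + r - 1 then 1 else 0) - ?\<delta>" if "i < n + r" for i
  proof -
    have "n + r - i = 1 \<longleftrightarrow> i = n + r - 1" using that by linarith
    then show ?thesis using that r(2) by (simp only: sum_moebius_mu_divisors_ge zero_less_diff)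
  qed
  have "(\<Sum>k = r..n + r. int (num_parts r (n + r) k) * moebius_mu k) =
      (\<Sum>i<n + r. ?c i * ((if i = n + r - 1 then 1 else 0) - ?\<delta>))"
    unfolding sum_num_parts_moebius_mu[OF r(1)]
    by (rule sum.cong[OF refl]) (simp only: lessThan_iff divisors)
  also have "\<dots> = ?c (n + r - 1) - (\<Sum>i<n + r. ?c i * ?\<delta>)"
    using r by (auto simp: right_diff_distrib sum_subtractf if_distrib[of "(*) _"] cong: if_cong)
  \<comment> \<open>For \<open>r = 1\<close> only \<open>?c n\<close> remains. For
    \<open>r = 2\<close> the term \<open>?c (n + 1)\<close> cancels the last summand, leaving minus
    the sum of \<open>?c i\<close> over \<open>i \<le> n\<close>.\<close>
  also have "\<dots> = (-1) ^ (r - 1) * int (num_partitions n)"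
    using r(2) restricted_partitions_1[of n] num_partitions_eq_sum[of n]
    by (elim disjE) (simp_all add: lessThan_Suc_atMost num_partitions_def)
  finally show ?thesis by (simp only: left_minus_one_mult_self)
qed

end
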